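(* There exists a nonempty open set $\mathcal{U}^1\subset\Omega^1$, with respect to the $C^\infty$-topology, such that: (a) $\mathcal{U}^1$ is determined by the $2$-jet of the vector fields, i.e. whether a vector field of $\Omega^1$ belongs to $\mathcal{U}^1$ depends only on its $2$-jet at the origin; (b) for each $X\in\mathcal{U}^1$ there is no symmetric periodic orbit arbitrarily close to the equilibrium point $0$; that is, there is a neighbourhood $W$ of $0$ in $\mathbb{R}^6$ containing no symmetric periodic orbit of $X$.
   Context: Fix coordinates $(x_1,y_1,x_2,y_2,x_3,y_3)$ on $\mathbb{R}^6$ and the standard symplectic form $\omega=dx_1\wedge dy_1+dx_2\wedge dy_2+dx_3\wedge dy_3$. For a (germ at the origin of a) smooth function $H:(\mathbb{R}^6,0)\to\mathbb{R}$ the Hamiltonian vector field $X_H$ is given by $\dot x_i=\partial H/\partial y_i$, $\dot y_i=-\partial H/\partial x_i$, $i=1,2,3$. All Hamiltonians considered have the origin as an equilibrium point: $X_H(0)=0$. Let $R_1$ be the linear symplectic involution $R_1(x_1,y_1,x_2,y_2,x_3,y_3)=(x_1,y_1,-x_2,-y_2,-x_3,-y_3)$, so $\dim\mathrm{Fix}(R_1)=2$. A vector field $X$ is $R_1$-reversible if $X(R_1x)=-R_1X(x)$ for all $x$; for $X=X_H$ with $H(0)=0$ this is equivalent to $H\circ R_1=-H$. $\Omega^1$ denotes the space of $C^\infty$ $R_1$-reversible Hamiltonian vector fields on $(\mathbb{R}^6,0)$ having the origin as an equilibrium, endowed with the $C^\infty$-topology. A periodic orbit is a nonconstant one (the equilibrium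 is not counted); a periodic orbit $\gamma$ is symmetric if $R_1(\gamma)=\gamma$. *)

theory Defs
  imports "HOL-Analysis.Analysis"
begin

text \<open>
  The coordinates \<open>(x\<^sub>1, y\<^sub>1, x\<^sub>2, y\<^sub>2, x\<^sub>3, y\<^sub>3)\<close> of a point \<open>z\<close> are
  \<open>z $ 1, \<dots>, z $ 6\<close>.  (The index type has \<open>6 = 0\<close>, which is harmless.)
\<close>

type_synonym point = "real ^ 6"
type_synonym vfield = "point \<Rightarrow> point"

subsection \<open>Smooth maps and jets\<close>

definition partial_deriv :: "6 \<Rightarrow> (point \<Rightarrow> 'b::real_normed_vector) \<Rightarrow> point \<Rightarrow> 'b"
  where "partial_deriv i f z = frechet_derivative f (at z) (axis i 1)"

primrec iter_partial :: "6 list \<Rightarrow> (point \<Rightarrow> 'b::real_normed_vector) \<Rightarrow> point \<Rightarrow> 'b"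
  where
    "iter_partial [] f = f"
  | "iter_partial (i # is) f = partial_deriv i (iter_partial is f)"

text \<open>
  Meant for open \<open>V\<close>.  Differentiability of all iterated partial derivatives makes them all
  continuous, so this is \<open>C\<^sup>\<infinity>\<close> on \<open>V\<close>.  Values outside \<open>V\<close> are irrelevant.
\<close>

definition smooth_on :: "point set \<Rightarrow> (point \<Rightarrow> 'b::real_normed_vector) \<Rightarrow> bool"
  where "smooth_on V f \<longleftrightarrow> (\<forall>is. \<forall>z\<in>V. iter_partial is f differentiable (at z))"

text \<open>The \<open>k\<close>-jet at the origin, recorded as the family of partial derivatives of order at most \<open>k\<close>.\<close>

definition jet :: "nat \<Rightarrow> (point \<Rightarrow> 'b::real_normed_vector) \<Rightarrow> 6 list \<Rightarrow> 'b"
  where "jet k f = (\<lambda>is. if length is \<le> k then iter_partial is f 0 else 0)"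

subsection \<open>Germs at the origin and their \<open>C\<^sup>\<infinity>\<close>-topology\<close>

definition germ :: "vfield \<Rightarrow> vfield set"
  where "germ X = {Y. \<forall>\<^sub>F z in nhds 0. Y z = X z}"

definition smooth_germs :: "vfield set set"
  where "smooth_germs = {germ X | X. \<exists>V. open V \<and> 0 \<in> V \<and> smooth_on V X}"

text \<open>
  The usual Frechet topology of \<open>C\<^sup>\<infinity>(V, \<real>\<^sup>6)\<close>: uniform convergence on compact subsets
  of \<open>V\<close> of all partial derivatives.
\<close>

definition Cinf_nbhd :: "point set \<Rightarrow> point set \<Rightarrow> nat \<Rightarrow> real \<Rightarrow> vfield \<Rightarrow> vfield set"
  where "Cinf_nbhd V K m e X =
    {Y. smooth_on V Y \<and>
        (\<forall>is. length is \<le> m \<longrightarrow>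
           (\<forall>z\<in>K. norm (iter_partial is Y z - iter_partial is X z) < e))}"

definition Cinf_topology :: "point set \<Rightarrow> vfield topology"
  where "Cinf_topology V = topology (\<lambda>U. U \<subseteq> {X. smooth_on V X} \<and>
    (\<forall>X\<in>U. \<exists>K m e. compact K \<and> K \<subseteq> V \<and> 0 < e \<and> Cinf_nbhd V K m e X \<subseteq> U))"

text \<open>
  Germs carry the final topology with respect to the maps \<open>C\<^sup>\<infinity>(V, \<real>\<^sup>6) \<rightarrow> smooth_germs\<close>
  for all open neighbourhoods \<open>V\<close> of the origin.
\<close>

definition germ_topology :: "vfield set topology"
  where "germ_topology = topology (\<lambda>U. U \<subseteq> smooth_germs \<and>
    (\<forall>V. open V \<and> 0 \<in> V \<longrightarrow> openin (Cinf_topology V) {X. smooth_on V X \<and> germ X \<in> U}))"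

lemma openin_Cinf_topology:
  "openin (Cinf_topology V) U \<longleftrightarrow> U \<subseteq> {X. smooth_on V X} \<and>
    (\<forall>X\<in>U. \<exists>K m e. compact K \<and> K \<subseteq> V \<and> 0 < e \<and> Cinf_nbhd V K m e X \<subseteq> U)"
proof -
  let ?P = "\<lambda>U. U \<subseteq> {X. smooth_on V X} \<and>
    (\<forall>X\<in>U. \<exists>K m e. compact K \<and> K \<subseteq> V \<and> 0 < e \<and> Cinf_nbhd V K m e X \<subseteq> U)"
  have Int: "?P (S \<inter> T)" if S: "?P S" and T: "?P T" for S T
  proof (intro conjI ballI)
    show "S \<inter> T \<subseteq> {X. smooth_on V X}" using S by blast
    fix X assume X: "X \<in> S \<inter> T"
    obtain K m e where 1: "compact K" "K \<subseteq> V" "0 < e" "Cinf_nbhd V K m e X \<subseteq> S"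
      using S X by blast
    obtain K' m' e' where 2: "compact K'" "K' \<subseteq> V" "0 < e'" "Cinf_nbhd V K' m' e' X \<subseteq> T"
      using T X by blast
    have "Cinf_nbhd V (K \<union> K') (max m m') (min e e') X
            \<subseteq> Cinf_nbhd V K m e X \<inter> Cinf_nbhd V K' m' e' X"
      unfolding Cinf_nbhd_def by (intro subsetI) simp
    then have "Cinf_nbhd V (K \<union> K') (max m m') (min e e') X \<subseteq> S \<inter> T"
      using 1(4) 2(4) by blast
    moreover have "compact (K \<union> K')" "K \<union> K' \<subseteq> V" "0 < min e e'"
      using 1 2 by (auto intro: compact_Un)
    ultimately show "\<exists>K m e. compact K \<and> K \<subseteq> V \<and> 0 < e \<and> Cinf_nbhd V K m e X \<subseteq> S \<inter> T"
      by blast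
  qed
  have Un: "?P (\<Union>\<K>)" if K: "\<forall>S\<in>\<K>. ?P S" for \<K>
  proof (intro conjI ballI)
    show "\<Union>\<K> \<subseteq> {X. smooth_on V X}" using K by (simp add: Sup_le_iff)
    fix X assume "X \<in> \<Union>\<K>"
    then obtain S where S: "S \<in> \<K>" "X \<in> S" by blast
    from bspec[OF K S(1)] S(2)
    obtain K m e where 1: "compact K" "K \<subseteq> V" "0 < e" "Cinf_nbhd V K m e X \<subseteq> S"
      by blast
    have "Cinf_nbhd V K m e X \<subseteq> \<Union>\<K>" using 1(4) S(1) by (rule order.trans[OF _ Union_upper])
    then show "\<exists>K m e. compact K \<and> K \<subseteq> V \<and> 0 < e \<and> Cinf_nbhd V K m e X \<subseteq> \<Union>\<K>"
      using 1(1-3) by blast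
  qed
  have "istopology ?P"
    unfolding istopology_def
  proof (rule conjI; intro allI impI)
    fix S T assume "?P S" "?P T"
    then show "?P (S \<inter> T)" by (rule Int)
  next
    fix \<K> assume "\<forall>S\<in>\<K>. ?P S"
    then show "?P (\<Union>\<K>)" by (rule Un)
  qed
  then show ?thesis unfolding Cinf_topology_def by (simp only: topology_inverse')
qed

lemma topspace_Cinf_topology: "topspace (Cinf_topology V) = {X. smooth_on V X}"
proof (rule subset_antisym)
  show "topspace (Cinf_topology V) \<subseteq> {X. smooth_on V X}"
    using openin_Cinf_topology[of V "topspace (Cinf_topology V)"] by blast
  have "openin (Cinf_topology V) {X. smooth_on V X}"
    unfolding openin_Cinf_topology
  proof (intro conjI ballI)
    fix X
    have "compact {} \<and> {} \<subseteq> V \<and> 0 < (1::real) \<and> Cinf_nbhd V {} 0 1 X \<subseteq> {X. smooth_on V X}"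
      by (simp add: Cinf_nbhd_def)
    then show "\<exists>K m e. compact K \<and> K \<subseteq> V \<and> 0 < e \<and> Cinf_nbhd V K m e X \<subseteq> {X. smooth_on V X}"
      by blast
  qed simp
  then show "{X. smooth_on V X} \<subseteq> topspace (Cinf_topology V)"
    by (rule openin_subset)
qed

lemma openin_germ_topology:
  "openin germ_topology U \<longleftrightarrow> U \<subseteq> smooth_germs \<and>
    (\<forall>V. open V \<and> 0 \<in> V \<longrightarrow> openin (Cinf_topology V) {X. smooth_on V X \<and> germ X \<in> U})"
proof -
  let ?P = "\<lambda>U. U \<subseteq> smooth_germs \<and>
    (\<forall>V. open V \<and> 0 \<in> V \<longrightarrow> openin (Cinf_topology V) {X. smooth_on V X \<and> germ X \<in> U})"
  have Int: "?P (S \<inter> T)" if S: "?P S" and T: "?P T" for S T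
  proof (intro conjI allI impI)
    show "S \<inter> T \<subseteq> smooth_germs" using S by blast
    fix V :: "point set" assume V: "open V \<and> 0 \<in> V"
    have "{X. smooth_on V X \<and> germ X \<in> S \<inter> T} =
          {X. smooth_on V X \<and> germ X \<in> S} \<inter> {X. smooth_on V X \<and> germ X \<in> T}" by blast
    then show "openin (Cinf_topology V) {X. smooth_on V X \<and> germ X \<in> S \<inter> T}"
      using S T V by (simp only: openin_Int)
  qed
  have Un: "?P (\<Union>\<K>)" if K: "\<forall>S\<in>\<K>. ?P S" for \<K>
  proof (intro conjI allI impI)
    show "\<Union>\<K> \<subseteq> smooth_germs" using K by (simp add: Sup_le_iff)
    fix V :: "point set" assume V: "open V \<and> 0 \<in> V"
    have "{X. smooth_on V X \<and> germ X \<in> \<Union>\<K>} =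
          (\<Union>S\<in>\<K>. {X. smooth_on V X \<and> germ X \<in> S})" by blast
    moreover have "openin (Cinf_topology V) (\<Union>S\<in>\<K>. {X. smooth_on V X \<and> germ X \<in> S})"
    proof (rule openin_Union, elim imageE)
      fix A S assume "A = {X. smooth_on V X \<and> germ X \<in> S}" and "S \<in> \<K>"
      then show "openin (Cinf_topology V) A" using K V by simp
    qed
    ultimately show "openin (Cinf_topology V) {X. smooth_on V X \<and> germ X \<in> \<Union>\<K>}" by simp
  qed
  have "istopology ?P"
    unfolding istopology_def
  proof (rule conjI; intro allI impI)
    fix S T assume "?P S" "?P T"
    then show "?P (S \<inter> T)" by (rule Int)
  next
    fix \<K> assume "\<forall>S\<in>\<K>. ?P S"
    then show "?P (\<Union>\<K>)" by (rule Un)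
  qed
  then show ?thesis unfolding germ_topology_def by (simp only: topology_inverse')
qed

lemma topspace_germ_topology: "topspace germ_topology = smooth_germs"
proof (rule subset_antisym)
  show "topspace germ_topology \<subseteq> smooth_germs"
    using openin_germ_topology[of "topspace germ_topology"] by blast
  have "openin germ_topology smooth_germs"
    unfolding openin_germ_topology
  proof (intro conjI allI impI)
    fix V :: "point set" assume "open V \<and> 0 \<in> V"
    then have "{X. smooth_on V X \<and> germ X \<in> smooth_germs} = topspace (Cinf_topology V)"
      unfolding topspace_Cinf_topology smooth_germs_def by blast
    then show "openin (Cinf_topology V) {X. smooth_on V X \<and> germ X \<in> smooth_germs}"
      by simp
  qed simp
  then show "smooth_germs \<subseteq> topspace germ_topology" by (rule openin_subset)
qed

subsection \<open>Reversible Hamiltonian vector fields\<close>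

definition R1 :: "point \<Rightarrow> point"
  where "R1 z = (\<chi> i. if i = 1 \<or> i = 2 then z $ i else - z $ i)"

definition ham_vf :: "(point \<Rightarrow> real) \<Rightarrow> vfield"
  where "ham_vf H z = (\<chi> i.
    if i = 1 then partial_deriv 2 H z
    else if i = 2 then - partial_deriv 1 H z
    else if i = 3 then partial_deriv 4 H z
    else if i = 4 then - partial_deriv 3 H z
    else if i = 5 then partial_deriv 6 H z
    else - partial_deriv 5 H z)"

definition rev_ham_vf :: "vfield \<Rightarrow> bool"
  where "rev_ham_vf X \<longleftrightarrow>
    (\<exists>V H. open V \<and> 0 \<in> V \<and> smooth_on V X \<and> smooth_on V H \<and> (\<forall>z\<in>V. X z = ham_vf H z)) \<and>
    (\<forall>\<^sub>F z in nhds 0. X (R1 z) = - R1 (X z)) \<and>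
    X 0 = 0"

definition Omega1 :: "vfield set set"
  where "Omega1 = {germ X | X. rev_ham_vf X}"

definition Omega1_topology :: "vfield set topology"
  where "Omega1_topology = subtopology germ_topology Omega1"

lemma topspace_Omega1_topology: "topspace Omega1_topology = Omega1"
proof -
  have "Omega1 \<subseteq> smooth_germs"
    unfolding Omega1_def smooth_germs_def rev_ham_vf_def by blast
  then show ?thesis
    unfolding Omega1_topology_def topspace_subtopology topspace_germ_topology by blast
qed

subsection \<open>Symmetric periodic orbits\<close>

definition periodic_orbit :: "vfield \<Rightarrow> point set \<Rightarrow> bool"
  where "periodic_orbit X \<gamma> \<longleftrightarrow> (\<exists>(u::real \<Rightarrow> point) T. T > 0 \<and>
    (\<forall>t. (u has_vector_derivative X (u t)) (at t)) \<and>
    (\<forall>t. u (t + T) = u t) \<and> \<not> u constant_on UNIV \<and> \<gamma> = range u)"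

definition symmetric_periodic_orbit :: "vfield \<Rightarrow> point set \<Rightarrow> bool"
  where "symmetric_periodic_orbit X \<gamma> \<longleftrightarrow> periodic_orbit X \<gamma> \<and> R1 ` \<gamma> = \<gamma>"

end

theory Submission
  imports Defs
begin

text \<open>
  For \<open>X\<close> in \<open>\<Omega>\<^sup>1\<close> the Hamiltonian is odd in \<open>w = (x\<^sub>2, y\<^sub>2, x\<^sub>3, y\<^sub>3)\<close>, so its quadratic part pairs
  \<open>p = (x\<^sub>1, y\<^sub>1)\<close> with \<open>w\<close> bilinearly.  The linear part of \<open>X\<close> exchanges \<open>p\<close> and \<open>w\<close>: it always has
  the eigenvalue \<open>0\<close> with multiplicity at least two, and its other four eigenvalues are
  \<open>\<plusminus>\<lambda>\<close>, each double, with \<open>\<lambda>\<^sup>2\<close> real.  If \<open>\<lambda>\<close> is real and nonzero, small periodic orbits live on a two-dimensional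
  centre manifold, which is tangent to a plane on which \<open>R\<^sub>1\<close> is \<open>-1\<close>.  The fixed plane of \<open>R\<^sub>1\<close> is
  transverse to it, whereas every symmetric periodic orbit has to meet that fixed plane.  So there are
  no small symmetric periodic orbits in the hyperbolic case, and already the \<open>1\<close>-jet detects this case.

  Instead of a centre manifold the proof uses a cone.  The field \<open>saddle\<close>, with Hamiltonian
  \<open>y\<^sub>1 x\<^sub>2 + x\<^sub>1 y\<^sub>2\<close>, is one linear representative of the hyperbolic case (\<open>\<lambda> = 1\<close>), and the open set
  consists of the germs in \<open>\<Omega>\<^sup>1\<close> whose linear part is close to it.  The quadratic form
  \<open>Q = 2 x\<^sub>1 x\<^sub>2 - 2 y\<^sub>1 y\<^sub>2 - x\<^sub>3\<^sup>2 - y\<^sub>3\<^sup>2\<close>, which is \<open>z \<bullet> cone_map z\<close> below, vanishes on the fixed plane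
  of \<open>R\<^sub>1\<close> and strictly increases along \<open>saddle\<close> wherever \<open>Q \<ge> 0\<close> and \<open>z \<noteq> 0\<close>.  The rate of increase
  is bounded below by a multiple of \<open>|z|\<^sup>2\<close>, so that it survives an error of size at most \<open>|z| / 4\<close> in the field
  (\<open>cone_form_increasing\<close>).

  A symmetric periodic orbit meets the fixed plane (\<open>symmetric_orbit_meets_Fix\<close>), so the maximum of
  \<open>Q\<close> along it is at least \<open>0\<close>.  The derivative of \<open>Q\<close> along the orbit vanishes where the maximum is
  attained, hence that point is the origin (\<open>periodic_orbit_meeting_cone_reaches_0\<close>).  The origin is an equilibrium,
  so by uniqueness of solutions the orbit is constant, a contradiction.
\<close>

section \<open>Partial derivatives on six-dimensional space\<close>

lemma UNIV_6: "(UNIV :: 6 set) = {1, 2, 3, 4, 5, 6}"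
proof -
  have "card {1, 2, 3, 4, 5, 6 :: 6} = CARD(6)" by simp
  then show ?thesis by (metis card_subset_eq finite_class.finite_UNIV subset_UNIV)
qed

lemma sum_6: "(\<Sum>i\<in>(UNIV :: 6 set). f i) = f 1 + f 2 + f 3 + f 4 + f 5 + f 6"
  for f :: "6 \<Rightarrow> 'a::comm_monoid_add"
  unfolding UNIV_6 by (simp add: ac_simps)

lemma forall_6: "(\<forall>i::6. P i) \<longleftrightarrow> P 1 \<and> P 2 \<and> P 3 \<and> P 4 \<and> P 5 \<and> P 6"
  by (metis UNIV_6 UNIV_I empty_iff insert_iff)

lemma partial_deriv_eq:
  assumes "(f has_derivative D) (at z)"
  shows "partial_deriv i f z = D (axis i 1)"
  using frechet_derivative_at[OF assms] by (simp add: partial_deriv_def)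

text \<open>
  The hypotheses on vector fields and the topology on germs speak of partial derivatives only;
  through this formula they control the total derivative.
\<close>
lemma has_derivative_partials:
  assumes "f differentiable (at z)"
  shows "(f has_derivative (\<lambda>h. \<Sum>i\<in>UNIV. h $ i *\<^sub>R partial_deriv i f z)) (at z)"
proof -
  let ?D = "frechet_derivative f (at z)"
  have D: "(f has_derivative ?D) (at z)" using assms frechet_derivative_works by blast
  have "?D h = (\<Sum>i\<in>UNIV. h $ i *\<^sub>R partial_deriv i f z)" for h
  proof -
    have lin: "linear ?D" using D has_derivative_linear by blast
    have "?D h = ?D (\<Sum>i\<in>UNIV. h $ i *\<^sub>R axis i 1)"
      using basis_expansion[of h] by (simp add: scalar_mult_eq_scaleR)
    then show ?thesis
      by (simp add: linear_sum[OF lin] linear_cmul[OF lin] partial_deriv_def)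
  qed
  then have "?D = (\<lambda>h. \<Sum>i\<in>UNIV. h $ i *\<^sub>R partial_deriv i f z)" by blast
  with D show ?thesis by simp
qed

lemma norm_partials_le:
  fixes a :: "6 \<Rightarrow> 'b::real_normed_vector"
  shows "norm (\<Sum>i\<in>UNIV. h $ i *\<^sub>R a i) \<le> (\<Sum>i\<in>UNIV. norm (a i)) * norm (h :: point)"
proof -
  have "norm (h $ i *\<^sub>R a i) \<le> norm (a i) * norm h" for i
    using mult_right_mono[OF component_le_norm_cart[of h i], of "norm (a i)"] by (simp add: mult.commute)
  then show ?thesis
    by (auto simp: sum_distrib_right intro!: order.trans[OF norm_sum] sum_mono)
qed

lemma smooth_on_partials:
  assumes "smooth_on V f" "z \<in> V"
  shows "f differentiable (at z)" "partial_deriv i f differentiable (at z)"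
proof -
  have "\<And>is. iter_partial is f differentiable (at z)" using assms by (auto simp: smooth_on_def)
  from this[of "[]"] this[of "[i]"]
  show "f differentiable (at z)" "partial_deriv i f differentiable (at z)" by simp_all
qed

text \<open>
  The first partial derivatives are themselves differentiable, hence continuous, hence bounded near
  the point, and the mean value inequality applies on a ball.
\<close>
lemma smooth_on_imp_locally_lipschitz:
  fixes f :: "point \<Rightarrow> 'b::real_normed_vector"
  assumes "open V" "a \<in> V" "smooth_on V f"
  obtains r L where "r > 0" "\<And>x y. x \<in> ball a r \<Longrightarrow> y \<in> ball a r \<Longrightarrow> norm (f x - f y) \<le> L * norm (x - y)"
proof -
  define B where "B i = norm (partial_deriv i f a) + 1" for i
  have "\<forall>\<^sub>F z in nhds a. \<forall>i. norm (partial_deriv i f z) < B i"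
  proof (rule eventually_all_finite)
    fix i
    have "isCont (partial_deriv i f) a"
      using smooth_on_partials(2)[OF assms(3,2)] differentiable_imp_continuous_within by blast
    then have "((\<lambda>z. norm (partial_deriv i f z)) \<longlongrightarrow> norm (partial_deriv i f a)) (nhds a)"
      by (intro tendsto_norm) (simp add: continuous_at tendsto_nhds_iff)
    then show "\<forall>\<^sub>F z in nhds a. norm (partial_deriv i f z) < B i"
      by (rule order_tendstoD) (simp add: B_def)
  qed
  then have "\<forall>\<^sub>F z in nhds a. z \<in> V \<and> (\<forall>i. norm (partial_deriv i f z) < B i)"
    using assms eventually_nhds_in_open by (intro eventually_conj) auto
  then obtain r where r: "r > 0" "\<And>z. z \<in> ball a r \<Longrightarrow> z \<in> V \<and> (\<forall>i. norm (partial_deriv i f z) < B i)"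
    by (auto simp: eventually_nhds_metric dist_commute)
  show ?thesis
  proof
    show "r > 0" by fact
    fix x y assume "x \<in> ball a r" "y \<in> ball a r"
    moreover have "onorm (\<lambda>h. \<Sum>i\<in>UNIV. h $ i *\<^sub>R partial_deriv i f z) \<le> (\<Sum>i\<in>UNIV. B i)"
      if "z \<in> ball a r" for z
    proof (rule onorm_bound)
      show "0 \<le> (\<Sum>i\<in>UNIV. B i)" by (intro sum_nonneg) (simp add: B_def)
      fix h :: point
      have "(\<Sum>i\<in>UNIV. norm (partial_deriv i f z)) \<le> (\<Sum>i\<in>UNIV. B i)"
        using r(2)[OF that] by (intro sum_mono) (simp add: less_imp_le)
      then show "norm (\<Sum>i\<in>UNIV. h $ i *\<^sub>R partial_deriv i f z) \<le> (\<Sum>i\<in>UNIV. B i) * norm h"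
        by (intro order.trans[OF norm_partials_le] mult_right_mono) auto
    qed
    moreover have "(f has_derivative (\<lambda>h. \<Sum>i\<in>UNIV. h $ i *\<^sub>R partial_deriv i f z)) (at z within ball a r)"
      if "z \<in> ball a r" for z
      using has_derivative_partials smooth_on_partials(1)[OF assms(3)] r(2)[OF that]
        has_derivative_at_withinI by blast
    ultimately show "norm (f x - f y) \<le> (\<Sum>i\<in>UNIV. B i) * norm (x - y)"
      by (intro differentiable_bound[OF convex_ball]) auto
  qed
qed

section \<open>Uniqueness of solutions\<close>

text \<open>Gronwall: the function \<open>exp (- K * t) * g t\<close> is nonincreasing and starts at zero.\<close>

lemma gronwall_zero:
  fixes g :: "real \<Rightarrow> real"
  assumes der: "\<And>t. (g has_real_derivative g' t) (at t)"
    and le: "\<And>t. g' t \<le> K * g t" and nonneg: "\<And>t. g t \<ge> 0"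
    and "g a = 0" "a \<le> t"
  shows "g t = 0"
proof -
  have "exp (- K * t) * g t \<le> exp (- K * a) * g a"
  proof (rule DERIV_nonpos_imp_nonincreasing[OF \<open>a \<le> t\<close>])
    fix x
    have "((\<lambda>t. exp (- K * t) * g t) has_real_derivative exp (- K * x) * (g' x - K * g x)) (at x)"
      by (auto intro!: derivative_eq_intros der simp: algebra_simps)
    moreover have "exp (- K * x) * (g' x - K * g x) \<le> 0"
      using le by (simp add: mult_nonneg_nonpos)
    ultimately show "\<exists>y. ((\<lambda>t. exp (- K * t) * g t) has_real_derivative y) (at x) \<and> y \<le> 0"
      by blast
  qed
  with \<open>g a = 0\<close> have "g t \<le> 0" by (simp add: mult_le_0_iff)
  with nonneg[of t] show ?thesis by simp
qed

text \<open>
  The squared distance \<open>g\<close> of the two solutions satisfies \<open>\<bar>g'\<bar> \<le> 2 L g\<close>.  The estimate is two-sided, so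
  it also covers times before \<open>a\<close>, by reversing time.  A Lipschitz bound along the pair of solutions
  suffices, which is what is available for a field that is known only near the origin.
\<close>
lemma ode_solution_unique:
  fixes u v :: "real \<Rightarrow> 'a::real_inner"
  assumes u: "\<And>t. (u has_vector_derivative X (u t)) (at t)"
    and v: "\<And>t. (v has_vector_derivative X (v t)) (at t)"
    and lip: "\<And>t. norm (X (u t) - X (v t)) \<le> L * norm (u t - v t)"
    and a: "u a = v a"
  shows "u t = v t"
proof -
  define g where "g t = (u t - v t) \<bullet> (u t - v t)" for t
  define g' where "g' t = 2 * ((u t - v t) \<bullet> (X (u t) - X (v t)))" for t
  have der: "(g has_real_derivative g' t) (at t)" for t
  proof -
    have "((\<lambda>t. u t - v t) has_derivative (\<lambda>h. h *\<^sub>R (X (u t) - X (v t)))) (at t)"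
      using has_vector_derivative_diff[OF u v] by (simp add: has_vector_derivative_def)
    from has_derivative_inner[OF this this] show ?thesis
      unfolding g_def g'_def has_field_derivative_def
      by (rule has_derivative_eq_rhs) (auto simp: inner_commute algebra_simps)
  qed
  have bound: "\<bar>g' t\<bar> \<le> 2 * L * g t" for t
  proof -
    have "\<bar>g' t\<bar> \<le> 2 * (norm (u t - v t) * norm (X (u t) - X (v t)))"
      using Cauchy_Schwarz_ineq2[of "u t - v t"] by (simp add: g'_def abs_mult)
    also have "\<dots> \<le> 2 * (norm (u t - v t) * (L * norm (u t - v t)))"
      by (intro mult_left_mono lip) auto
    finally show ?thesis by (simp add: g_def dot_square_norm power2_eq_square mult_ac)
  qed
  have nonneg: "g t \<ge> 0" for t by (simp add: g_def)
  have "g a = 0" by (simp add: g_def a)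
  have "g t = 0"
  proof (cases "a \<le> t")
    case True
    show ?thesis
      by (rule gronwall_zero[of g g' "2 * L", OF der _ nonneg \<open>g a = 0\<close> True])
        (use bound abs_le_D1 in blast)
  next
    case False
    have "((\<lambda>s. g (- s)) has_real_derivative - g' (- s)) (at s)" for s
      using DERIV_chain'[OF DERIV_minus[OF DERIV_ident] der[of "- s"]] by simp
    from gronwall_zero[OF this, of "2 * L" "- a" "- t"] show ?thesis
      using bound nonneg \<open>g a = 0\<close> False abs_le_D2 by auto
  qed
  then show ?thesis by (simp add: g_def)
qed

section \<open>Symmetric orbits and the fixed plane of the involution\<close>

lemma R1_minus [simp]: "R1 (- z) = - R1 z"
  by (auto simp: R1_def vec_eq_iff)

lemma bounded_linear_R1: "bounded_linear R1"
proof (rule linear_conv_bounded_linear[THEN iffD1], rule linearI)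
  show "R1 (x + y) = R1 x + R1 y" "R1 (c *\<^sub>R x) = c *\<^sub>R R1 x" for x y c
    by (simp_all add: R1_def vec_eq_iff)
qed

text \<open>
  Reversibility makes \<open>t \<mapsto> R1 (u (- t))\<close> a solution.  By symmetry it starts at a point
  \<open>u \<tau>\<close> of the same orbit, so it is the time shift \<open>t \<mapsto> u (t + \<tau>)\<close>.  The two agree at \<open>t = - \<tau> / 2\<close>, the
  time at which the arguments \<open>- t\<close> and \<open>t + \<tau>\<close> coincide.
\<close>
lemma symmetric_orbit_meets_Fix:
  assumes u: "\<And>t. (u has_vector_derivative X (u t)) (at t)"
    and rev: "\<And>t. X (R1 (u t)) = - R1 (X (u t))"
    and sym: "R1 ` range u = range u"
    and lip: "\<And>x y. x \<in> range u \<Longrightarrow> y \<in> range u \<Longrightarrow> norm (X x - X y) \<le> L * norm (x - y)"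
  shows "\<exists>t. R1 (u t) = u t"
proof -
  obtain \<tau> where \<tau>: "R1 (u 0) = u \<tau>" using sym by blast
  define v where "v t = R1 (u (- t))" for t
  define w where "w t = u (t + \<tau>)" for t
  have v: "(v has_vector_derivative X (v t)) (at t)" for t
  proof -
    have "((\<lambda>t. u (- t)) has_vector_derivative - X (u (- t))) (at t)"
      using vector_diff_chain_at[of uminus "-1" t u "X (u (- t))"] u[of "- t"]
        has_vector_derivative_minus[OF has_vector_derivative_id]
      by (simp add: o_def)
    from bounded_linear.has_vector_derivative[OF bounded_linear_R1 this]
    show ?thesis unfolding v_def by (simp add: rev)
  qed
  have w: "(w has_vector_derivative X (w t)) (at t)" for t
    using vector_diff_chain_at[of "\<lambda>t. t + \<tau>" 1 t u "X (u (t + \<tau>))"] u[of "t + \<tau>"]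
      has_vector_derivative_add[OF has_vector_derivative_id has_vector_derivative_const]
    unfolding w_def by (simp add: o_def)
  have "v (- \<tau> / 2) = w (- \<tau> / 2)"
  proof (rule ode_solution_unique[OF v w, where a = 0 and L = L])
    show "norm (X (v t) - X (w t)) \<le> L * norm (v t - w t)" for t
      using sym by (intro lip) (auto simp: v_def w_def)
    show "v 0 = w 0" by (simp add: v_def w_def \<tau>)
  qed
  then show ?thesis by (auto simp: v_def w_def)
qed

section \<open>The model saddle and its cone\<close>

definition saddle :: vfield
  where "saddle z = (\<chi> i.
    if i = 1 then z $ 3 else if i = 2 then - z $ 4
    else if i = 3 then z $ 1 else if i = 4 then - z $ 2 else 0)"

text \<open>
  The symmetric matrix of the quadratic form \<open>2 x\<^sub>1 x\<^sub>2 - 2 y\<^sub>1 y\<^sub>2 - x\<^sub>3\<^sup>2 - y\<^sub>3\<^sup>2\<close>.  On the first four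
  coordinates it equals \<open>saddle\<close>, so that the form grows along \<open>saddle\<close> at the rate of twice the squared
  length of these coordinates.  The negative terms in the centre directions \<open>x\<^sub>3, y\<^sub>3\<close> bound them by the
  other coordinates inside the cone where the form is nonnegative.
\<close>
definition cone_map :: "point \<Rightarrow> point"
  where "cone_map z = (\<chi> i.
    if i = 1 then z $ 3 else if i = 2 then - z $ 4
    else if i = 3 then z $ 1 else if i = 4 then - z $ 2 else - z $ i)"

lemma bounded_linear_saddle: "bounded_linear saddle"
  by (rule linear_conv_bounded_linear[THEN iffD1], rule linearI)
    (auto simp: saddle_def vec_eq_iff)

lemma bounded_linear_cone_map: "bounded_linear cone_map"
  by (rule linear_conv_bounded_linear[THEN iffD1], rule linearI)
    (auto simp: cone_map_def vec_eq_iff)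

lemma cone_map_selfadjoint: "cone_map x \<bullet> y = x \<bullet> cone_map y"
  by (simp add: inner_vec_def sum_6 cone_map_def)

lemma norm_cone_map: "norm (cone_map z) = norm z"
  by (simp add: norm_eq_sqrt_inner inner_vec_def sum_6 cone_map_def)

lemma cone_form_Fix: "R1 z = z \<Longrightarrow> z \<bullet> cone_map z = 0"
  by (auto simp: R1_def vec_eq_iff forall_6 inner_vec_def sum_6 cone_map_def)

text \<open>
  The left-hand side is half the derivative of the cone form in the direction \<open>v\<close>.  Inside
  the cone at least half of \<open>|z|\<^sup>2\<close> sits in the first four coordinates, so \<open>saddle\<close> contributes at
  least \<open>|z|\<^sup>2 / 2\<close>; the error contributes at most \<open>|z|\<^sup>2 / 4\<close>, because \<open>cone_map\<close> is an isometry.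
\<close>
lemma cone_form_increasing:
  assumes "z \<bullet> cone_map z \<ge> 0" "z \<noteq> 0" and err: "norm (v - saddle z) \<le> norm z / 4"
  shows "cone_map z \<bullet> v > 0"
proof -
  define h where "h = (z $ 1)\<^sup>2 + (z $ 2)\<^sup>2 + (z $ 3)\<^sup>2 + (z $ 4)\<^sup>2"
  have "0 \<le> 2 * (z $ 1 * z $ 3) - 2 * (z $ 2 * z $ 4) - (z $ 5)\<^sup>2 - (z $ 6)\<^sup>2"
    using assms(1) by (simp add: inner_vec_def sum_6 cone_map_def power2_eq_square)
  also have "\<dots> \<le> h - (z $ 5)\<^sup>2 - (z $ 6)\<^sup>2"
  proof -
    have "0 \<le> (z $ 1 - z $ 3)\<^sup>2" "0 \<le> (z $ 2 + z $ 4)\<^sup>2" by simp_all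
    then show ?thesis unfolding h_def power2_diff power2_sum by simp
  qed
  \<comment> \<open>\<open>(norm z)\<^sup>2\<close> is the sum of \<open>h\<close> and the squares of the two centre coordinates.\<close>
  finally have "(norm z)\<^sup>2 \<le> 2 * h"
    unfolding power2_norm_eq_inner by (simp add: h_def inner_vec_def sum_6 power2_eq_square)
  moreover have "cone_map z \<bullet> saddle z = h"
    by (simp add: h_def inner_vec_def sum_6 cone_map_def saddle_def power2_eq_square)
  moreover have "\<bar>cone_map z \<bullet> (v - saddle z)\<bar> \<le> (norm z)\<^sup>2 / 4"
  proof -
    have "\<bar>cone_map z \<bullet> (v - saddle z)\<bar> \<le> norm z * norm (v - saddle z)"
      using Cauchy_Schwarz_ineq2[of "cone_map z"] by (simp add: norm_cone_map)
    also have "\<dots> \<le> norm z * (norm z / 4)" using err by (intro mult_left_mono) auto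
    finally show ?thesis by (simp add: power2_eq_square)
  qed
  moreover have "(norm z)\<^sup>2 > 0" using \<open>z \<noteq> 0\<close> by simp
  ultimately show ?thesis unfolding inner_diff_right by linarith
qed

text \<open>
  Periodicity turns the maximum of the cone form over one period into a maximum over all times, at
  which its derivative vanishes.  The maximal value is nonnegative because the orbit meets the cone, and
  inside the cone the derivative can vanish only at the origin.
\<close>
lemma periodic_orbit_meeting_cone_reaches_0:
  assumes u: "\<And>t. (u has_vector_derivative X (u t)) (at t)"
    and per: "\<And>t. u (t + T) = u t" "T > 0"
    and err: "\<And>t. norm (X (u t) - saddle (u t)) \<le> norm (u t) / 4"
    and cone: "u a \<bullet> cone_map (u a) \<ge> 0"
  shows "\<exists>t. u t = 0"
proof -
  define g where "g t = u t \<bullet> cone_map (u t)" for t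
  have der: "(g has_real_derivative 2 * (cone_map (u t) \<bullet> X (u t))) (at t)" for t
  proof -
    have 1: "(u has_derivative (\<lambda>h. h *\<^sub>R X (u t))) (at t)"
      using u by (simp add: has_vector_derivative_def)
    have 2: "((\<lambda>t. cone_map (u t)) has_derivative (\<lambda>h. cone_map (h *\<^sub>R X (u t)))) (at t)"
      using bounded_linear.has_derivative[OF bounded_linear_cone_map 1] .
    show ?thesis
      using has_derivative_inner[OF 1 2] unfolding g_def has_field_derivative_def
      by (rule has_derivative_eq_rhs)
        (auto simp: cone_map_selfadjoint[symmetric] inner_commute algebra_simps)
  qed
  have "continuous_on {a..a + T} g"
    using der DERIV_isCont by (intro continuous_at_imp_continuous_on) blast
  then obtain s where s: "\<And>t. t \<in> {a..a + T} \<Longrightarrow> g t \<le> g s"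
    using continuous_attains_sup[of "{a..a + T}" g] per(2) by force
  have max: "g t \<le> g s" for t
  proof -
    interpret periodic_fun_simple g T by unfold_locales (simp add: g_def per)
    define n where "n = \<lfloor>(t - a) / T\<rfloor>"
    have "of_int n \<le> (t - a) / T" "(t - a) / T < of_int n + 1" by (auto simp: n_def)
    then have "t - of_int n * T \<in> {a..a + T}" using per(2) by (auto simp: field_simps)
    from s[OF this] show ?thesis by (simp add: minus_of_int)
  qed
  have "cone_map (u s) \<bullet> X (u s) = 0"
    using DERIV_local_max[OF der[of s], of 1] max by simp
  moreover have "u s \<bullet> cone_map (u s) \<ge> 0" using max[of a] cone by (simp add: g_def)
  ultimately show ?thesis using cone_form_increasing[OF _ _ err] by fastforce
qed

section \<open>Fields whose linear part is close to the saddle\<close>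

text \<open>
  The bound \<open>1 / 48\<close> on each of the six columns makes the linear parts differ by at most \<open>1 / 8\<close> in
  operator norm.  This leaves \<open>1 / 8\<close> of the admissible error \<open>1 / 4\<close> for the nonlinear terms.
\<close>
definition near_saddle :: "vfield \<Rightarrow> bool"
  where "near_saddle X \<longleftrightarrow> (\<forall>i. norm (partial_deriv i X 0 - saddle (axis i 1)) < 1 / 48)"

lemma near_saddle_error:
  assumes "near_saddle X" "X differentiable (at 0)" "X 0 = 0"
  shows "\<forall>\<^sub>F z in nhds 0. norm (X z - saddle z) \<le> norm z / 4"
proof -
  let ?D = "\<lambda>h. \<Sum>i\<in>UNIV. h $ i *\<^sub>R partial_deriv i X 0"
  obtain d where d: "d > 0" "\<And>z. norm z < d \<Longrightarrow> norm (X z - ?D z) \<le> 1 / 8 * norm z"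
    using has_derivative_partials[OF assms(2), unfolded has_derivative_at_alt,
        THEN conjunct2, rule_format, of "1 / 8"] \<open>X 0 = 0\<close> by auto
  have "norm (X z - saddle z) \<le> norm z / 4" if "norm z < d" for z
  proof -
    have "saddle z = (\<Sum>i\<in>UNIV. z $ i *\<^sub>R saddle (axis i 1))"
    proof -
      have lin: "linear saddle" using bounded_linear_saddle by (rule bounded_linear.linear)
      have "saddle z = saddle (\<Sum>i\<in>UNIV. z $ i *\<^sub>R axis i 1)"
        using basis_expansion[of z] by (simp add: scalar_mult_eq_scaleR)
      then show ?thesis by (simp add: linear_sum[OF lin] linear_cmul[OF lin])
    qed
    then have "?D z - saddle z = (\<Sum>i\<in>UNIV. z $ i *\<^sub>R (partial_deriv i X 0 - saddle (axis i 1)))"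
      by (simp add: scaleR_diff_right sum_subtractf)
    also have "norm \<dots> \<le> (\<Sum>i\<in>UNIV. norm (partial_deriv i X 0 - saddle (axis i 1))) * norm z"
      by (rule norm_partials_le)
    also have "\<dots> \<le> (\<Sum>i\<in>(UNIV::6 set). 1 / 48) * norm z"
      using assms(1) by (intro mult_right_mono sum_mono) (auto simp: near_saddle_def less_imp_le)
    finally have "norm (?D z - saddle z) \<le> 1 / 8 * norm z" by simp
    with d(2)[OF that] norm_triangle_ineq[of "X z - ?D z" "?D z - saddle z"] show ?thesis by simp
  qed
  then show ?thesis using d(1) by (auto simp: eventually_nhds_metric)
qed

section \<open>The open set of germs\<close>

lemma germ_eq_iff: "germ X = germ Y \<longleftrightarrow> (\<forall>\<^sub>F z in nhds 0. X z = Y z)"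
proof
  assume "germ X = germ Y"
  moreover have "X \<in> germ X" by (simp add: germ_def)
  ultimately show "\<forall>\<^sub>F z in nhds 0. X z = Y z" by (simp add: germ_def)
next
  assume *: "\<forall>\<^sub>F z in nhds 0. X z = Y z"
  show "germ X = germ Y"
    unfolding germ_def using * by (auto elim: eventually_elim2)
qed

lemma partial_deriv_germ_cong:
  assumes "\<forall>\<^sub>F z in nhds a. X z = Y z"
  shows "partial_deriv i X a = partial_deriv i Y a"
proof -
  obtain S where "open S" "a \<in> S" "\<And>z. z \<in> S \<Longrightarrow> X z = Y z"
    using assms by (auto simp: eventually_nhds)
  then have "(X has_derivative D) (at a) \<longleftrightarrow> (Y has_derivative D) (at a)" for D
    using has_derivative_transform_within_open[of X D a UNIV S Y]
      has_derivative_transform_within_open[of Y D a UNIV S X] by auto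
  then show ?thesis by (simp add: partial_deriv_def frechet_derivative_def)
qed

lemma near_saddle_germ_cong: "germ X = germ Y \<Longrightarrow> near_saddle X \<longleftrightarrow> near_saddle Y"
  using partial_deriv_germ_cong[of X Y 0] by (simp add: near_saddle_def germ_eq_iff)

lemma near_saddle_2_jet_cong: "jet 2 X = jet 2 Y \<Longrightarrow> near_saddle X \<longleftrightarrow> near_saddle Y"
proof -
  assume "jet 2 X = jet 2 Y"
  then have "jet 2 X [i] = jet 2 Y [i]" for i by simp
  then show ?thesis by (simp add: jet_def near_saddle_def)
qed

definition near_saddle_germs :: "vfield set set"
  where "near_saddle_germs = {germ X | X. germ X \<in> smooth_germs \<and> near_saddle X}"

lemma germ_in_near_saddle_germs_iff:
  "germ X \<in> near_saddle_germs \<longleftrightarrow> germ X \<in> smooth_germs \<and> near_saddle X"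
proof
  assume "germ X \<in> near_saddle_germs"
  then obtain Z where Z: "germ X = germ Z" "germ Z \<in> smooth_germs" "near_saddle Z"
    unfolding near_saddle_germs_def by blast
  with near_saddle_germ_cong[OF Z(1)] show "germ X \<in> smooth_germs \<and> near_saddle X" by simp
next
  assume "germ X \<in> smooth_germs \<and> near_saddle X"
  then show "germ X \<in> near_saddle_germs" unfolding near_saddle_germs_def by blast
qed

text \<open>
  The condition consists of finitely many strict inequalities between first derivatives at the origin, so
  the compact set \<open>{0}\<close> and derivatives of order at most one suffice for a basic neighbourhood; its
  radius \<open>e\<close> is the smallest gap in these inequalities.
\<close>
lemma openin_near_saddle_germs: "openin germ_topology near_saddle_germs"
  unfolding openin_germ_topology
proof (intro conjI allI impI)
  show "near_saddle_germs \<subseteq> smooth_germs" by (auto simp: near_saddle_germs_def)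
  fix V :: "point set" assume V: "open V \<and> 0 \<in> V"
  then have eq: "smooth_on V X \<and> germ X \<in> near_saddle_germs \<longleftrightarrow> smooth_on V X \<and> near_saddle X" for X
    unfolding germ_in_near_saddle_germs_iff smooth_germs_def by blast
  show "openin (Cinf_topology V) {X. smooth_on V X \<and> germ X \<in> near_saddle_germs}"
    unfolding openin_Cinf_topology eq
  proof (intro conjI ballI)
    fix X assume "X \<in> {X. smooth_on V X \<and> near_saddle X}"
    then have X: "near_saddle X" by simp
    define gap where "gap i = 1 / 48 - norm (partial_deriv i X 0 - saddle (axis i 1))" for i
    define e where "e = Min (range gap)"
    have "e > 0" using X by (simp add: e_def gap_def near_saddle_def)
    moreover have "Cinf_nbhd V {0} 1 e X \<subseteq> {X. smooth_on V X \<and> near_saddle X}"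
    proof
      fix Y assume Y: "Y \<in> Cinf_nbhd V {0} 1 e X"
      have "norm (partial_deriv i Y 0 - saddle (axis i 1)) < 1 / 48" for i
      proof -
        have "length [i] \<le> 1 \<longrightarrow> norm (iter_partial [i] Y 0 - iter_partial [i] X 0) < e"
          using Y unfolding Cinf_nbhd_def by blast
        then have "norm (partial_deriv i Y 0 - partial_deriv i X 0) < e" by simp
        also have "e \<le> gap i" by (simp add: e_def)
        finally show ?thesis
          using norm_triangle_ineq[of "partial_deriv i Y 0 - partial_deriv i X 0"
            "partial_deriv i X 0 - saddle (axis i 1)"] by (simp add: gap_def)
      qed
      then show "Y \<in> {X. smooth_on V X \<and> near_saddle X}"
        using Y by (simp add: near_saddle_def Cinf_nbhd_def)
    qed
    ultimately show "\<exists>K m e. compact K \<and> K \<subseteq> V \<and> 0 < e \<and>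
        Cinf_nbhd V K m e X \<subseteq> {X. smooth_on V X \<and> near_saddle X}"
      using V by (intro exI[of _ "{0}"] exI[of _ 1] exI[of _ e]) auto
  qed auto
qed

section \<open>Absence of small symmetric periodic orbits\<close>

text \<open>
  The given representative \<open>X\<close> of the germ may be arbitrary away from the origin.  The neighbourhood \<open>W\<close> is
  chosen so small that on it \<open>X\<close> coincides with a smooth representative \<open>Y\<close>, and \<open>Y\<close> is Lipschitz,
  reversible and close to the saddle there.
\<close>
lemma near_saddle_no_symmetric_periodic_orbit:
  assumes "germ X \<in> Omega1" "near_saddle X"
  shows "\<exists>W. open W \<and> 0 \<in> W \<and> \<not> (\<exists>\<gamma>. symmetric_periodic_orbit X \<gamma> \<and> \<gamma> \<subseteq> W)"
proof -
  obtain Y where XY: "germ X = germ Y" and Y: "rev_ham_vf Y"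
    using assms(1) unfolding Omega1_def by blast
  then obtain V where V: "open V" "0 \<in> V" "smooth_on V Y" unfolding rev_ham_vf_def by blast
  have Y0: "Y 0 = 0" and rev: "\<forall>\<^sub>F z in nhds 0. Y (R1 z) = - R1 (Y z)"
    using Y unfolding rev_ham_vf_def by blast+
  obtain r L where r: "r > 0"
    and lip: "\<And>x y. x \<in> ball 0 r \<Longrightarrow> y \<in> ball 0 r \<Longrightarrow> norm (Y x - Y y) \<le> L * norm (x - y)"
    using smooth_on_imp_locally_lipschitz[OF V] by metis
  have "near_saddle Y" using assms(2) XY near_saddle_germ_cong by blast
  then have err: "\<forall>\<^sub>F z in nhds 0. norm (Y z - saddle z) \<le> norm z / 4"
    using near_saddle_error smooth_on_partials(1)[OF V(3,2)] Y0 by blast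
  have "\<forall>\<^sub>F z in nhds 0. X z = Y z" using XY by (simp add: germ_eq_iff)
  moreover have "\<forall>\<^sub>F z in nhds 0. z \<in> ball 0 r" using r by (intro eventually_nhds_in_open) auto
  ultimately have "\<forall>\<^sub>F z in nhds 0. X z = Y z \<and> z \<in> ball 0 r \<and> Y (R1 z) = - R1 (Y z) \<and>
      norm (Y z - saddle z) \<le> norm z / 4"
    using rev err by eventually_elim blast
  then obtain W where W: "open W" "0 \<in> W"
    and good: "\<And>z. z \<in> W \<Longrightarrow> X z = Y z \<and> z \<in> ball 0 r \<and> Y (R1 z) = - R1 (Y z) \<and>
      norm (Y z - saddle z) \<le> norm z / 4"
    unfolding eventually_nhds by blast
  have False if "symmetric_periodic_orbit X \<gamma>" "\<gamma> \<subseteq> W" for \<gamma>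
  proof -
    obtain u T where uX: "\<And>t. (u has_vector_derivative X (u t)) (at t)"
      and T: "T > 0" "\<And>t. u (t + T) = u t" and nc: "\<not> u constant_on UNIV"
      and \<gamma>: "\<gamma> = range u" and sym: "R1 ` range u = range u"
      using \<open>symmetric_periodic_orbit X \<gamma>\<close>
      unfolding symmetric_periodic_orbit_def periodic_orbit_def by blast
    have inW: "u t \<in> W" for t using \<gamma> \<open>\<gamma> \<subseteq> W\<close> by auto
    have u: "(u has_vector_derivative Y (u t)) (at t)" for t using uX[of t] good[OF inW[of t]] by simp
    have "\<exists>a. R1 (u a) = u a"
    proof (rule symmetric_orbit_meets_Fix[OF u _ sym])
      show "Y (R1 (u t)) = - R1 (Y (u t))" for t using good[OF inW] by blast
      show "norm (Y x - Y y) \<le> L * norm (x - y)" if "x \<in> range u" "y \<in> range u" for x y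
        using that \<gamma> \<open>\<gamma> \<subseteq> W\<close> good by (intro lip) blast+
    qed
    then obtain a where "R1 (u a) = u a" ..
    then have "u a \<bullet> cone_map (u a) \<ge> 0" by (simp add: cone_form_Fix)
    moreover have "norm (Y (u t) - saddle (u t)) \<le> norm (u t) / 4" for t
      using good[OF inW] by blast
    ultimately obtain b where b: "u b = 0"
      using periodic_orbit_meeting_cone_reaches_0[OF u T(2,1)] by blast
    have "u t = 0" for t
    proof (rule ode_solution_unique[OF u, where v = "\<lambda>_. 0" and a = b and L = L])
      show "((\<lambda>_. 0) has_vector_derivative Y 0) (at t)" for t by (simp add: Y0)
      show "norm (Y (u t) - Y 0) \<le> L * norm (u t - 0)" for t
        using good[OF inW[of t]] r by (intro lip) auto
    qed (use b in simp)
    then have "u constant_on UNIV" by (auto simp: constant_on_def)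
    with nc show False by contradiction
  qed
  with W show ?thesis by blast
qed

section \<open>The saddle is a reversible Hamiltonian field\<close>

text \<open>
  A coinductive criterion: all iterated partial derivatives stay in the class, so none of them has to be
  computed.
\<close>
lemma smooth_on_if_closed_class:
  assumes "f \<in> F" "\<And>g z. g \<in> F \<Longrightarrow> g differentiable (at z)"
    and "\<And>g i. g \<in> F \<Longrightarrow> partial_deriv i g \<in> F"
  shows "smooth_on V f"
proof -
  have "iter_partial is f \<in> F" for "is"
    by (induction "is") (use assms in auto)
  with assms(2) show ?thesis by (simp add: smooth_on_def)
qed

text \<open>In the coordinates \<open>x\<^sub>i, y\<^sub>i\<close> this is \<open>y\<^sub>1 x\<^sub>2 + x\<^sub>1 y\<^sub>2\<close>.\<close>
definition saddle_ham :: "point \<Rightarrow> real"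
  where "saddle_ham z = z $ 2 * z $ 3 + z $ 1 * z $ 4"

lemma has_derivative_affine:
  assumes "bounded_linear l"
  shows "((\<lambda>z. c + l z) has_derivative l) (at z)"
  using bounded_linear_imp_has_derivative[OF assms] by (auto intro!: derivative_eq_intros)

lemma smooth_on_bounded_linear:
  fixes l :: "point \<Rightarrow> 'b::real_normed_vector"
  assumes "bounded_linear l"
  shows "smooth_on V l"
proof (rule smooth_on_if_closed_class)
  let ?F = "{\<lambda>z. c + l z | c (l :: point \<Rightarrow> 'b). bounded_linear l}"
  show "l \<in> ?F" using assms by (auto intro!: exI[of _ 0] exI[of _ l])
  fix g assume "g \<in> ?F"
  then obtain c l' where g: "g = (\<lambda>z. c + l' z)" "bounded_linear l'" by blast
  show "g differentiable (at z)" for z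
    using has_derivative_affine[OF g(2)] unfolding g(1) differentiable_def by blast
  have "partial_deriv i g = (\<lambda>z. l' (axis i 1) + 0)" for i
    using partial_deriv_eq[OF has_derivative_affine[OF g(2)]] unfolding g(1) by auto
  then show "partial_deriv i g \<in> ?F" for i
    by (intro CollectI exI[of _ "l' (axis i 1)"] exI[of _ "\<lambda>_. 0"]) simp
qed

lemma has_derivative_saddle_ham:
  "(saddle_ham has_derivative (\<lambda>h. z $ 2 * h $ 3 + h $ 2 * z $ 3 + (z $ 1 * h $ 4 + h $ 1 * z $ 4))) (at z)"
  unfolding saddle_ham_def[abs_def]
  by (auto intro!: derivative_eq_intros
      bounded_linear_imp_has_derivative[OF bounded_linear_vec_nth])

lemma smooth_on_saddle_ham: "smooth_on V saddle_ham"
proof (rule smooth_on_if_closed_class)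
  let ?F = "insert saddle_ham {l. \<forall>V. smooth_on V l}"
  fix g assume "g \<in> ?F"
  then consider "g = saddle_ham" | "\<forall>V. smooth_on V g" by blast
  note cases = this
  show "g differentiable (at z)" for z
    using cases
  proof cases
    case 1
    then show ?thesis using has_derivative_saddle_ham by (auto simp: differentiable_def)
  next
    case 2
    then show ?thesis using smooth_on_partials(1)[of "{z}" g z] by simp
  qed
  show "partial_deriv i g \<in> ?F" for i
    using cases
  proof cases
    case 1
    have "bounded_linear (partial_deriv i g)"
      unfolding 1 partial_deriv_eq[OF has_derivative_saddle_ham, abs_def]
      by (rule linear_conv_bounded_linear[THEN iffD1], rule linearI) (auto simp: algebra_simps)
    then show ?thesis using smooth_on_bounded_linear by blast
  next
    case 2
    have "iter_partial is (partial_deriv i g) = iter_partial (is @ [i]) g" for "is"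
      by (induction "is") auto
    with 2 show ?thesis by (simp add: smooth_on_def)
  qed
qed simp

lemma ham_vf_saddle_ham: "ham_vf saddle_ham z = saddle z"
  by (simp add: ham_vf_def saddle_def vec_eq_iff forall_6
      partial_deriv_eq[OF has_derivative_saddle_ham] axis_def)

lemma rev_ham_vf_saddle: "rev_ham_vf saddle"
  unfolding rev_ham_vf_def
proof (intro conjI)
  show "\<exists>V H. open V \<and> 0 \<in> V \<and> smooth_on V saddle \<and> smooth_on V H \<and> (\<forall>z\<in>V. saddle z = ham_vf H z)"
    using smooth_on_bounded_linear[OF bounded_linear_saddle] smooth_on_saddle_ham ham_vf_saddle_ham
    by (intro exI[of _ UNIV] exI[of _ saddle_ham]) auto
  show "\<forall>\<^sub>F z in nhds 0. saddle (R1 z) = - R1 (saddle z)"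
    by (rule always_eventually) (simp add: saddle_def R1_def vec_eq_iff forall_6)
  show "saddle 0 = 0" by (simp add: saddle_def vec_eq_iff)
qed

lemma near_saddle_saddle: "near_saddle saddle"
  using partial_deriv_eq[OF bounded_linear_imp_has_derivative[OF bounded_linear_saddle]]
  by (simp add: near_saddle_def)

section \<open>The open set without small symmetric periodic orbits\<close>

theorem theoremB:
  shows "\<exists>U. openin Omega1_topology U \<and> U \<noteq> {} \<and>
    (\<forall>X Y. germ X \<in> Omega1 \<and> germ Y \<in> Omega1 \<and> jet 2 X = jet 2 Y \<longrightarrow>
       (germ X \<in> U \<longleftrightarrow> germ Y \<in> U)) \<and>
    (\<forall>X. germ X \<in> U \<longrightarrow>
       (\<exists>W. open W \<and> 0 \<in> W \<and> \<not> (\<exists>\<gamma>. symmetric_periodic_orbit X \<gamma> \<and> \<gamma> \<subseteq> W)))"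
proof -
  let ?U = "near_saddle_germs \<inter> Omega1"
  have sub: "Omega1 \<subseteq> smooth_germs"
    unfolding Omega1_def smooth_germs_def rev_ham_vf_def by blast
  have mem: "germ X \<in> ?U \<longleftrightarrow> germ X \<in> Omega1 \<and> near_saddle X" for X
    using germ_in_near_saddle_germs_iff sub by blast
  have "openin Omega1_topology ?U"
    unfolding Omega1_topology_def openin_subtopology using openin_near_saddle_germs by blast
  moreover have "germ saddle \<in> ?U"
    using mem rev_ham_vf_saddle near_saddle_saddle unfolding Omega1_def by blast
  moreover have "germ X \<in> ?U \<longleftrightarrow> germ Y \<in> ?U"
    if "germ X \<in> Omega1" "germ Y \<in> Omega1" "jet 2 X = jet 2 Y" for X Y
    using that mem near_saddle_2_jet_cong by blast
  moreover have "\<exists>W. open W \<and> 0 \<in> W \<and> \<not> (\<exists>\<gamma>. symmetric_periodic_orbit X \<gamma> \<and> \<gamma> \<subseteq> W)"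
    if "germ X \<in> ?U" for X
    using that mem near_saddle_no_symmetric_periodic_orbit by blast
  ultimately show ?thesis by (intro exI[of _ ?U]) blast
qed

end
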